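(* Let $G$ be a group generated by a subset $S$, endowed with the word metric $d_S$. Then $G$ is boundedly presented by $S$ if and only if the metric space $(G,d_S)$ is coarsely simply connected. In particular, a locally compact compactly generated group $G$, endowed with the word metric with respect to a compact generating subset, is compactly presented if and only if it is coarsely simply connected.
   Context: Word metric: for a generating subset $S$ of $G$, $d_S(g,h)$ is the least $n\ge 0$ such that $g^{-1}h$ is a product of $n$ elements of $S\cup S^{-1}$. Boundedly presented: $G$ is boundedly presented by $S\subset G$ if, as an abstract group, it has a presentation with $S$ as set of generators and with relators of bounded length (as words in $S\cup S^{-1}$). Compactly presented: a topological group is compactly presented if it is Hausdorff and it has a compact subset $S$ such that the abstract group $G$ is boundedly presented by $S$. Compactly generated means generated, as an abstract group, by some compact subset. Locally compact groups are assumed Hausdorff. Coarse notions: let $X$ be a metric space and $r\ge 0$. An $r$-path is a finite sequence $(x_0,\dots,x_n)$ in $X$ with $d(x_i,x_{i+1})\le r$ for all $i$; it joins $x_0$ to $x_n$; if $x_n=x_0$ it is an $r$-loop based at $x_0$. The $r$-equivalence (also called $r$-homotopy) is the equivalence relation on $r$-paths generated by $(x_0,\dots,x_n)\sim(x_0,\dots,x_i,y,x_{i+1},\dots,x_n)$ (both sequences being $r$-paths). The trivial loop based at $x_0$ is the constant loop $(x_0,x_0)$, identified with the one-term sequence $(x_0)$. $X$ is coarsely connected if for some $r$ every two points of $X$ are joined by an $r$-path. $X$ is coarsely simply connected if it is coarsely connected and for every $r$ there exists $r'\ge r$ such that every $r$-loop is $r'$-homotopic to the trivial loop (based at the same point).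 *)

theory Defs
  imports "HOL-Analysis.Analysis" "HOL-Algebra.Coset" "HOL-Algebra.Generated_Groups"
begin

section \<open>Free groups and presentations\<close>

text \<open>The letter \<open>(True, s)\<close> stands for the generator \<open>s\<close> and \<open>(False, s)\<close> for its formal inverse.
  The free group on \<open>S\<close> is realised on freely reduced words, so that the list length of an
  element is its length as a word in the generators and their inverses.\<close>

type_synonym 'a word = "(bool \<times> 'a) list"

definition letter_inv :: "bool \<times> 'a \<Rightarrow> bool \<times> 'a" where
  "letter_inv x = (\<not> fst x, snd x)"

definition freely_reduced :: "'a word \<Rightarrow> bool" where
  "freely_reduced w \<longleftrightarrow> successively (\<lambda>x y. y \<noteq> letter_inv x) w"

fun push_letter :: "bool \<times> 'a \<Rightarrow> 'a word \<Rightarrow> 'a word" where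
  "push_letter x [] = [x]"
| "push_letter x (y # w) = (if y = letter_inv x then w else x # y # w)"

definition free_reduce :: "'a word \<Rightarrow> 'a word" where
  "free_reduce w = foldr push_letter w []"

definition free_group :: "'a set \<Rightarrow> 'a word monoid" where
  "free_group S = \<lparr>carrier = {w. set w \<subseteq> UNIV \<times> S \<and> freely_reduced w},
                   mult = (\<lambda>u v. free_reduce (u @ v)), one = []\<rparr>"

definition letter_eval :: "('a, 'b) monoid_scheme \<Rightarrow> bool \<times> 'a \<Rightarrow> 'a" where
  "letter_eval G x = (if fst x then snd x else inv\<^bsub>G\<^esub> (snd x))"

definition word_eval :: "('a, 'b) monoid_scheme \<Rightarrow> 'a word \<Rightarrow> 'a" where
  "word_eval G w = foldr (\<lambda>x g. letter_eval G x \<otimes>\<^bsub>G\<^esub> g) w \<one>\<^bsub>G\<^esub>"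

definition normal_closure :: "('a, 'b) monoid_scheme \<Rightarrow> 'a set \<Rightarrow> 'a set" where
  "normal_closure G R = \<Inter>{N. N \<lhd> G \<and> R \<subseteq> N}"

text \<open>\<open>S\<close> and \<open>R\<close> present \<open>G\<close> when the homomorphism from the free group on \<open>S\<close> to \<open>G\<close> that
  extends the inclusion of \<open>S\<close> is onto and its kernel is the normal closure of \<open>R\<close>.\<close>

definition has_presentation :: "('a, 'b) monoid_scheme \<Rightarrow> 'a set \<Rightarrow> 'a word set \<Rightarrow> bool" where
  "has_presentation G S R \<longleftrightarrow>
     S \<subseteq> carrier G \<and> R \<subseteq> carrier (free_group S) \<and>
     word_eval G ` carrier (free_group S) = carrier G \<and>
     kernel (free_group S) G (word_eval G) = normal_closure (free_group S) R"

definition boundedly_presented :: "('a, 'b) monoid_scheme \<Rightarrow> 'a set \<Rightarrow> bool" where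
  "boundedly_presented G S \<longleftrightarrow>
     (\<exists>R. has_presentation G S R \<and> (\<exists>n. \<forall>r\<in>R. length r \<le> n))"

subsection \<open>Well-definedness\<close>

lemma letter_inv_invol [simp]: "letter_inv (letter_inv x) = x"
  by (simp add: letter_inv_def)

lemma letter_inv_swap: "x = letter_inv y \<longleftrightarrow> y = letter_inv x"
  by (metis letter_inv_invol)

lemma freely_reduced_Nil [simp]: "freely_reduced []"
  by (simp add: freely_reduced_def)

lemma freely_reduced_tl: "freely_reduced (x # w) \<Longrightarrow> freely_reduced w"
  by (cases w) (auto simp: freely_reduced_def)

lemma freely_reduced_push: "freely_reduced w \<Longrightarrow> freely_reduced (push_letter x w)"
  by (cases w) (auto simp: freely_reduced_def dest: freely_reduced_tl[unfolded freely_reduced_def])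

lemma freely_reduced_foldr: "freely_reduced v \<Longrightarrow> freely_reduced (foldr push_letter u v)"
  by (induction u) (auto intro: freely_reduced_push)

lemma push_push_inv:
  assumes "freely_reduced w"
  shows "push_letter x (push_letter (letter_inv x) w) = w"
proof (cases w)
  case (Cons y v)
  then show ?thesis using assms by (cases v) (auto simp: freely_reduced_def)
qed auto

lemma foldr_push_push:
  assumes "freely_reduced v"
  shows "foldr push_letter (push_letter x u) v = push_letter x (foldr push_letter u v)"
proof (cases u)
  case (Cons y w)
  then show ?thesis
    using push_push_inv[OF freely_reduced_foldr[OF assms], of x w] by auto
qed auto

lemma foldr_push_assoc:
  assumes "freely_reduced w"
  shows "foldr push_letter (foldr push_letter u v) w = foldr push_letter u (foldr push_letter v w)"
  by (induction u) (auto simp: foldr_push_push assms)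

lemma free_reduce_id: "freely_reduced w \<Longrightarrow> free_reduce w = w"
proof (induction w)
  case (Cons x w)
  have "free_reduce w = w" using Cons freely_reduced_tl by blast
  then show ?case using Cons.prems by (cases w) (auto simp: free_reduce_def freely_reduced_def)
qed (simp add: free_reduce_def)

lemma free_reduce_append: "freely_reduced v \<Longrightarrow> free_reduce (u @ v) = foldr push_letter u v"
  using free_reduce_id[of v] by (simp add: free_reduce_def)

lemma set_push: "set (push_letter x w) \<subseteq> insert x (set w)"
  by (cases w) auto

lemma set_foldr_push: "set (foldr push_letter u v) \<subseteq> set u \<union> set v"
proof (induction u)
  case (Cons x u)
  then show ?case using set_push[of x "foldr push_letter u v"] by auto
qed auto

lemma freely_reduced_rev_inv: "freely_reduced w \<Longrightarrow> freely_reduced (rev (map letter_inv w))"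
  unfolding freely_reduced_def successively_rev successively_map
  by (erule successively_mono) (metis letter_inv_invol)

lemma foldr_push_inv: 
  assumes "freely_reduced v"
  shows "foldr push_letter (rev (map letter_inv u)) (foldr push_letter u v) = v"
proof (induction u)
  case (Cons x u)
  then show ?case
    using push_push_inv[OF freely_reduced_foldr[OF assms], of "letter_inv x" u] by simp
qed simp

lemma group_free_group: "group (free_group S)"
proof (rule groupI)
  fix u v assume "u \<in> carrier (free_group S)" "v \<in> carrier (free_group S)"
  then show "u \<otimes>\<^bsub>free_group S\<^esub> v \<in> carrier (free_group S)"
    using set_foldr_push[of u v]
    by (auto simp: free_group_def free_reduce_append intro: freely_reduced_foldr)
next
  fix u v w assume "u \<in> carrier (free_group S)" "v \<in> carrier (free_group S)"
    "w \<in> carrier (free_group S)"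
  then show "u \<otimes>\<^bsub>free_group S\<^esub> v \<otimes>\<^bsub>free_group S\<^esub> w
      = u \<otimes>\<^bsub>free_group S\<^esub> (v \<otimes>\<^bsub>free_group S\<^esub> w)"
    by (simp add: free_group_def free_reduce_append freely_reduced_foldr foldr_push_assoc)
next
  fix u assume u: "u \<in> carrier (free_group S)"
  let ?v = "rev (map letter_inv u)"
  have "foldr push_letter ?v u = []"
    using foldr_push_inv[of "[]" u] free_reduce_id[of u] u
    by (simp add: free_group_def free_reduce_def)
  moreover have "?v \<in> carrier (free_group S)"
    using u by (auto simp: free_group_def freely_reduced_rev_inv letter_inv_def)
  ultimately show "\<exists>v\<in>carrier (free_group S). v \<otimes>\<^bsub>free_group S\<^esub> u = \<one>\<^bsub>free_group S\<^esub>"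
    using u by (intro bexI[of _ ?v]) (auto simp: free_group_def free_reduce_append)
qed (auto simp: free_group_def free_reduce_id)

context group
begin

lemma letter_eval_closed: "snd x \<in> carrier G \<Longrightarrow> letter_eval G x \<in> carrier G"
  by (simp add: letter_eval_def)

lemma word_eval_closed: "set w \<subseteq> UNIV \<times> carrier G \<Longrightarrow> word_eval G w \<in> carrier G"
  by (induction w) (auto simp: word_eval_def letter_eval_def)

lemma word_eval_push:
  assumes "set (x # w) \<subseteq> UNIV \<times> carrier G"
  shows "word_eval G (push_letter x w) = letter_eval G x \<otimes> word_eval G w"
proof (cases w)
  case (Cons y v)
  have "word_eval G v \<in> carrier G" using assms Cons by (intro word_eval_closed) auto
  moreover have "snd x \<in> carrier G" using assms by auto
  ultimately show ?thesis
    using Cons by (auto simp: word_eval_def letter_eval_def letter_inv_def m_assoc[symmetric])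
qed (simp add: word_eval_def)

lemma word_eval_foldr_push:
  assumes "set u \<subseteq> UNIV \<times> carrier G" "set v \<subseteq> UNIV \<times> carrier G"
  shows "word_eval G (foldr push_letter u v) = word_eval G u \<otimes> word_eval G v"
  using assms
proof (induction u)
  case Nil
  then show ?case using word_eval_closed by (simp add: word_eval_def)
next
  case (Cons x u)
  have "set (x # foldr push_letter u v) \<subseteq> UNIV \<times> carrier G"
    using set_foldr_push[of u v] Cons.prems by auto
  then have "word_eval G (foldr push_letter (x # u) v) =
      letter_eval G x \<otimes> (word_eval G u \<otimes> word_eval G v)"
    using Cons by (simp add: word_eval_push)
  also have "\<dots> = word_eval G (x # u) \<otimes> word_eval G v"
    using Cons.prems word_eval_closed[of u] word_eval_closed[of v] letter_eval_closed[of x]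
    by (auto simp: word_eval_def m_assoc)
  finally show ?case .
qed

lemma word_eval_hom: "S \<subseteq> carrier G \<Longrightarrow> word_eval G \<in> hom (free_group S) G"
  by (rule homI)
    (fastforce simp: free_group_def free_reduce_append
      intro!: word_eval_closed word_eval_foldr_push)+

end

section \<open>The word metric\<close>

text \<open>The value \<open>0\<close> off the carrier makes the distance symmetric and non-negative everywhere, as
  \<^locale>\<open>Metric_space\<close> requires.\<close>

definition word_metric :: "('a, 'b) monoid_scheme \<Rightarrow> 'a set \<Rightarrow> 'a \<Rightarrow> 'a \<Rightarrow> real" where
  "word_metric G S g h =
     (if g \<in> carrier G \<and> h \<in> carrier G
      then real (LEAST n. \<exists>xs. length xs = n \<and> set xs \<subseteq> S \<union> (\<lambda>s. inv\<^bsub>G\<^esub> s) ` S \<and>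
                               foldr (\<otimes>\<^bsub>G\<^esub>) xs \<one>\<^bsub>G\<^esub> = inv\<^bsub>G\<^esub> g \<otimes>\<^bsub>G\<^esub> h)
      else 0)"

context group
begin

context
  fixes S assumes S: "S \<subseteq> carrier G" "generate G S = carrier G"
begin

private definition W where
  "W g n \<longleftrightarrow> (\<exists>xs. length xs = n \<and> set xs \<subseteq> S \<union> (\<lambda>s. inv s) ` S \<and> foldr (\<otimes>) xs \<one> = g)"

private lemma foldr_closed: "set xs \<subseteq> S \<union> (\<lambda>s. inv s) ` S \<Longrightarrow> foldr (\<otimes>) xs \<one> \<in> carrier G"
  using S(1) by (induction xs) auto

private lemma foldr_append:
  assumes "set xs \<subseteq> S \<union> (\<lambda>s. inv s) ` S" "set ys \<subseteq> S \<union> (\<lambda>s. inv s) ` S"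
  shows "foldr (\<otimes>) (xs @ ys) \<one> = foldr (\<otimes>) xs \<one> \<otimes> foldr (\<otimes>) ys \<one>"
  using assms
proof (induction xs)
  case Nil
  then show ?case using foldr_closed[of ys] by simp
next
  case (Cons x xs)
  have "x \<in> carrier G" using Cons.prems S(1) by auto
  moreover have "foldr (\<otimes>) xs \<one> \<in> carrier G" "foldr (\<otimes>) ys \<one> \<in> carrier G"
    using Cons.prems by (auto intro!: foldr_closed)
  ultimately show ?case using Cons by (simp add: m_assoc)
qed

private lemma W_mult: "W g m \<Longrightarrow> W h n \<Longrightarrow> W (g \<otimes> h) (m + n)"
proof -
  assume "W g m" "W h n"
  then obtain xs ys where
    "length xs = m" "set xs \<subseteq> S \<union> (\<lambda>s. inv s) ` S" "foldr (\<otimes>) xs \<one> = g"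
    "length ys = n" "set ys \<subseteq> S \<union> (\<lambda>s. inv s) ` S" "foldr (\<otimes>) ys \<one> = h"
    unfolding W_def by blast
  then show "W (g \<otimes> h) (m + n)"
    unfolding W_def using foldr_append[of xs ys] by (intro exI[of _ "xs @ ys"]) auto
qed

private lemma W_letter: "x \<in> S \<union> (\<lambda>s. inv s) ` S \<Longrightarrow> W x 1"
  unfolding W_def using S(1) by (intro exI[of _ "[x]"]) auto

private lemma W_one: "W g 0 \<longleftrightarrow> g = \<one>"
  unfolding W_def by auto

private lemma W_inv: "W g n \<Longrightarrow> W (inv g) n"
proof (induction n arbitrary: g)
  case 0
  then show ?case by (simp add: W_one)
next
  case (Suc n)
  then obtain ys where "length ys = Suc n" "set ys \<subseteq> S \<union> (\<lambda>s. inv s) ` S" "foldr (\<otimes>) ys \<one> = g"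
    unfolding W_def by blast
  then obtain x xs where x: "x \<in> S \<union> (\<lambda>s. inv s) ` S" "set xs \<subseteq> S \<union> (\<lambda>s. inv s) ` S"
    "length xs = n" "g = x \<otimes> foldr (\<otimes>) xs \<one>"
    by (cases ys) auto
  have "W (inv (foldr (\<otimes>) xs \<one>)) n"
    using x by (intro Suc.IH) (auto simp: W_def)
  moreover have "W (inv x) 1"
    using x(1) S(1) by (intro W_letter) auto
  moreover have "inv g = inv (foldr (\<otimes>) xs \<one>) \<otimes> inv x"
    using x foldr_closed[OF x(2)] S(1) by (auto simp: inv_mult_group)
  ultimately show ?case using W_mult by fastforce
qed

private lemma W_ex: "g \<in> carrier G \<Longrightarrow> \<exists>n. W g n"
proof -
  assume "g \<in> carrier G"
  then have "g \<in> generate G S" using S by simp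
  then show ?thesis
  proof (induction rule: generate.induct)
    case one then show ?case using W_one by blast
  next
    case (incl h) then show ?case using W_letter by blast
  next
    case (inv h) then show ?case using W_letter by blast
  next
    case (eng h1 h2) then show ?case using W_mult by blast
  qed
qed

private lemma word_metric_W:
  "g \<in> carrier G \<Longrightarrow> h \<in> carrier G \<Longrightarrow> word_metric G S g h = real (LEAST n. W (inv g \<otimes> h) n)"
  unfolding word_metric_def W_def by simp

lemma Metric_space_word_metric: "Metric_space (carrier G) (word_metric G S)"
proof
  show "0 \<le> word_metric G S x y" for x y
    by (simp add: word_metric_def)
  show "word_metric G S x y = word_metric G S y x" for x y
  proof (cases "x \<in> carrier G \<and> y \<in> carrier G")
    case True
    have "W (inv a \<otimes> b) n \<Longrightarrow> W (inv b \<otimes> a) n" if "a \<in> carrier G" "b \<in> carrier G" for a b n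
      using W_inv[of "inv a \<otimes> b" n] that by (simp add: inv_mult_group)
    then have "W (inv x \<otimes> y) = W (inv y \<otimes> x)" using True by blast
    then show ?thesis using True by (simp add: word_metric_W)
  qed (auto simp: word_metric_def)
next
  fix x y assume xy: "x \<in> carrier G" "y \<in> carrier G"
  obtain n where n: "W (inv x \<otimes> y) n" using W_ex xy by blast
  have "word_metric G S x y = 0 \<longleftrightarrow> W (inv x \<otimes> y) 0"
    using LeastI[of "W (inv x \<otimes> y)", OF n] Least_le[of "W (inv x \<otimes> y)" 0] xy
    by (auto simp: word_metric_W)
  also have "\<dots> \<longleftrightarrow> x = y"
    using xy by (metis W_one l_inv inv_closed inv_equality inv_inv)
  finally show "word_metric G S x y = 0 \<longleftrightarrow> x = y" .
next
  fix x y z assume xyz: "x \<in> carrier G" "y \<in> carrier G" "z \<in> carrier G"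
  have "W (inv x \<otimes> y) (LEAST n. W (inv x \<otimes> y) n)" "W (inv y \<otimes> z) (LEAST n. W (inv y \<otimes> z) n)"
    using W_ex xyz by (auto intro: LeastI_ex)
  then have "W ((inv x \<otimes> y) \<otimes> (inv y \<otimes> z))
      ((LEAST n. W (inv x \<otimes> y) n) + (LEAST n. W (inv y \<otimes> z) n))"
    by (rule W_mult)
  moreover have "(inv x \<otimes> y) \<otimes> (inv y \<otimes> z) = inv x \<otimes> z"
    using xyz by (simp add: m_assoc) (simp add: m_assoc[symmetric])
  ultimately show "word_metric G S x z \<le> word_metric G S x y + word_metric G S y z"
    using xyz by (simp add: word_metric_W Least_le flip: of_nat_add)
qed

end

end

section \<open>Coarse simple connectedness\<close>

definition r_path :: "'a set \<Rightarrow> ('a \<Rightarrow> 'a \<Rightarrow> real) \<Rightarrow> real \<Rightarrow> 'a list \<Rightarrow> bool" where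
  "r_path M d r p \<longleftrightarrow> p \<noteq> [] \<and> set p \<subseteq> M \<and> successively (\<lambda>x y. d x y \<le> r) p"

definition r_loop :: "'a set \<Rightarrow> ('a \<Rightarrow> 'a \<Rightarrow> real) \<Rightarrow> real \<Rightarrow> 'a \<Rightarrow> 'a list \<Rightarrow> bool" where
  "r_loop M d r x0 p \<longleftrightarrow> r_path M d r p \<and> hd p = x0 \<and> last p = x0"

text \<open>The rule \<open>trivial\<close> implements the convention that the one-term sequence \<open>[x]\<close> is identified
  with the trivial loop \<open>[x, x]\<close>; the rule \<open>insert\<close> alone never applies to one-term sequences.\<close>

inductive r_homotopy_step ::
  "'a set \<Rightarrow> ('a \<Rightarrow> 'a \<Rightarrow> real) \<Rightarrow> real \<Rightarrow> 'a list \<Rightarrow> 'a list \<Rightarrow> bool" for M d r where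
  insert: "p \<noteq> [] \<Longrightarrow> q \<noteq> [] \<Longrightarrow> r_path M d r (p @ q) \<Longrightarrow> r_path M d r (p @ y # q) \<Longrightarrow>
           r_homotopy_step M d r (p @ q) (p @ y # q)"
| trivial: "r_path M d r [x, x] \<Longrightarrow> r_homotopy_step M d r [x] [x, x]"

definition r_homotopic ::
  "'a set \<Rightarrow> ('a \<Rightarrow> 'a \<Rightarrow> real) \<Rightarrow> real \<Rightarrow> 'a list \<Rightarrow> 'a list \<Rightarrow> bool" where
  "r_homotopic M d r p q \<longleftrightarrow>
     r_path M d r p \<and> r_path M d r q \<and> equivclp (r_homotopy_step M d r) p q"

definition coarsely_connected :: "'a set \<Rightarrow> ('a \<Rightarrow> 'a \<Rightarrow> real) \<Rightarrow> bool" where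
  "coarsely_connected M d \<longleftrightarrow>
     (\<exists>r\<ge>0. \<forall>x\<in>M. \<forall>y\<in>M. \<exists>p. r_path M d r p \<and> hd p = x \<and> last p = y)"

definition coarsely_simply_connected :: "'a set \<Rightarrow> ('a \<Rightarrow> 'a \<Rightarrow> real) \<Rightarrow> bool" where
  "coarsely_simply_connected M d \<longleftrightarrow>
     coarsely_connected M d \<and>
     (\<forall>r\<ge>0. \<exists>r'\<ge>r. \<forall>x0 p. r_loop M d r x0 p \<longrightarrow> r_homotopic M d r' p [x0, x0])"

section \<open>Topological groups\<close>

locale topological_group = group G for G (structure) +
  fixes T
  assumes topspace_eq_carrier: "topspace T = carrier G"
    and continuous_mult: "continuous_map (prod_topology T T) T (\<lambda>(x, y). x \<otimes> y)"
    and continuous_inv: "continuous_map T T (\<lambda>x. inv x)"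

definition compactly_generated :: "('a, 'b) monoid_scheme \<Rightarrow> 'a topology \<Rightarrow> bool" where
  "compactly_generated G T \<longleftrightarrow> (\<exists>S. compactin T S \<and> generate G S = carrier G)"

definition compactly_presented :: "('a, 'b) monoid_scheme \<Rightarrow> 'a topology \<Rightarrow> bool" where
  "compactly_presented G T \<longleftrightarrow>
     Hausdorff_space T \<and> (\<exists>S. compactin T S \<and> boundedly_presented G S)"

end

theory Submission
  imports Defs
begin

text \<open>A path in the word metric with steps of length at most one spells a word in the generators.
  A van Kampen argument in both directions: words that spell null-homotopic loops at a scale
  exceeding the relator lengths form a normal subgroup of the free group containing the relators,
  hence the whole kernel; conversely, if 1-loops are r-homotopic to trivial loops, then each
  elementary r-homotopy applies a relation of length at most 3r. Two compact generating sets of a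
  locally compact group give bi-Lipschitz word metrics, which reduces the second claim to the
  first.\<close>

section \<open>Coarse homotopy\<close>

text \<open>Two mismatches shape the argument. Elements of the free group are reduced words, so its
  product is concatenation followed by cancellation, and the path of a product is not the
  concatenated path. Cancelling a letter against its inverse contracts a loop of length 2; from
  scale 2 on, free reduction is therefore itself a homotopy, which is what makes the null-homotopic
  words a normal subgroup. In the converse direction, no word is rewritten along a homotopy. Each
  edge of a path is labelled by an element of the quotient of the free group by a normal subgroup
  containing the short relators, and the product of the labels is shown to be invariant. Inserting a
  point subdivides one edge, so invariance amounts to one relation per triangle; its three sides are
  the origin of the factor 3. In the topological part, the word metric need not induce the given
  topology, and its balls are not known beforehand to be neighbourhoods of \<open>\<one>\<close>.
  That a compact set is bounded in the word metric is thus a genuine claim, and local compactness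
  enters there.\<close>

lemma r_path_Cons:
  "r_path M d r (x # p) \<longleftrightarrow> x \<in> M \<and> (p = [] \<or> d x (hd p) \<le> r \<and> r_path M d r p)"
  by (auto simp: r_path_def successively_Cons)

lemma r_path_nonempty: "r_path M d r p \<Longrightarrow> p \<noteq> []"
  by (simp add: r_path_def)

lemma r_path_append:
  assumes "p \<noteq> []" "q \<noteq> []"
  shows "r_path M d r (p @ q) \<longleftrightarrow> r_path M d r p \<and> r_path M d r q \<and> d (last p) (hd q) \<le> r"
  using assms by (auto simp: r_path_def successively_append_iff)

lemma r_path_singleton [simp]: "r_path M d r [x] \<longleftrightarrow> x \<in> M"
  by (simp add: r_path_def)

lemma r_path_mono:
  assumes "r_path M d r p" "\<And>x y. \<lbrakk>x \<in> M; y \<in> M; d x y \<le> r\<rbrakk> \<Longrightarrow> d' x y \<le> r'"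
  shows "r_path M d' r' p"
proof -
  have "successively (\<lambda>x y. d' x y \<le> r') p"
    by (rule successively_mono[of "\<lambda>x y. d x y \<le> r"])
      (use assms in \<open>auto simp: r_path_def\<close>)
  then show ?thesis using assms(1) by (simp add: r_path_def)
qed

lemma r_homotopic_refl: "r_path M d r p \<Longrightarrow> r_homotopic M d r p p"
  by (simp add: r_homotopic_def)

lemma r_homotopic_sym: "r_homotopic M d r p q \<Longrightarrow> r_homotopic M d r q p"
  by (auto simp: r_homotopic_def intro: equivclp_sym)

lemma r_homotopic_trans [trans]:
  "r_homotopic M d r p q \<Longrightarrow> r_homotopic M d r q s \<Longrightarrow> r_homotopic M d r p s"
  by (auto simp: r_homotopic_def intro: equivclp_trans)

lemma r_homotopy_step_paths:
  "r_homotopy_step M d r p q \<Longrightarrow> r_path M d r p \<and> r_path M d r q"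
  by (induction rule: r_homotopy_step.induct) (auto simp: r_path_Cons)

lemma r_homotopic_step: "r_homotopy_step M d r p q \<Longrightarrow> r_homotopic M d r p q"
  using r_homotopy_step_paths[of M d r p q] by (auto simp: r_homotopic_def)

text \<open>The generated equivalence is a chain of steps taken in either direction. Each stage of
  the chain is handed over as homotopic to \<open>p\<close>, so that it is known to be an
  r-path.\<close>

lemma r_homotopic_induct [consumes 1, case_names base step]:
  assumes "r_homotopic M d r p q" "P p"
    and step: "\<And>u v. \<lbrakk>r_homotopic M d r p u;
        r_homotopy_step M d r u v \<or> r_homotopy_step M d r v u; P u\<rbrakk> \<Longrightarrow> P v"
  shows "P q"
proof -
  have "equivclp (r_homotopy_step M d r) p q" "r_path M d r p"
    using assms(1) by (auto simp: r_homotopic_def)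
  then have "r_homotopic M d r p q \<and> P q"
  proof induction
    case base
    then show ?case using assms(2) by (simp add: r_homotopic_refl)
  next
    case (step y z)
    then have "r_homotopic M d r y z"
      using r_homotopic_step r_homotopic_sym by metis
    then show ?case using step assms(3) r_homotopic_trans by metis
  qed
  then show ?thesis ..
qed

lemma r_homotopic_mono:
  assumes "r_homotopic M d r p q" "\<And>x y. \<lbrakk>x \<in> M; y \<in> M; d x y \<le> r\<rbrakk> \<Longrightarrow> d' x y \<le> r'"
  shows "r_homotopic M d' r' p q"
proof -
  have path: "r_path M d r u \<Longrightarrow> r_path M d' r' u" for u
    by (erule r_path_mono) (rule assms(2))
  have mono: "r_homotopy_step M d r u v \<Longrightarrow> r_homotopy_step M d' r' u v" for u v
    by (induction rule: r_homotopy_step.induct) (auto intro: r_homotopy_step.intros path)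
  from assms(1) show ?thesis
  proof (induction rule: r_homotopic_induct)
    case base
    then show ?case using assms(1) path by (auto simp: r_homotopic_def)
  next
    case (step u v)
    then show ?case
      using mono by (meson r_homotopic_step r_homotopic_sym r_homotopic_trans)
  qed
qed

lemma r_homotopic_endpoints:
  assumes "r_homotopic M d r p q"
  shows "hd q = hd p \<and> last q = last p"
  using assms
proof (induction rule: r_homotopic_induct)
  case (step u v)
  then show ?case
    by (auto elim!: r_homotopy_step.cases)
qed simp

section \<open>Homotopies inside longer paths, concatenation, and cones\<close>

context Metric_space
begin

text \<open>A repeated point is admissible because its distance to itself is 0. A neighbour on one
  side suffices for the rule \<open>insert\<close>; only a one-point path calls for
  \<open>trivial\<close>.\<close>

lemma r_homotopic_duplicate:
  assumes "0 \<le> r" and path: "r_path M d r (p @ x # q)"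
  shows "r_homotopic M d r (p @ x # q) (p @ x # x # q)"
proof -
  have x: "x \<in> M" using path by (simp add: r_path_def)
  then have path': "r_path M d r (p @ x # x # q)"
    using assms by (cases "p = []") (auto simp: r_path_append r_path_Cons)
  show ?thesis
  proof (cases "p = [] \<and> q = []")
    case True
    then show ?thesis
      using path' by (auto intro: r_homotopic_step r_homotopy_step.trivial)
  next
    case False
    then consider "p \<noteq> []" | "q \<noteq> []" by blast
    then show ?thesis
    proof cases
      case 1
      then show ?thesis
        using path path' by (intro r_homotopic_step r_homotopy_step.insert) auto
    next
      case 2
      then show ?thesis
        using path path' r_homotopy_step.insert[of "p @ [x]" q M d r x]
        by (intro r_homotopic_step) auto
    qed
  qed
qed

lemma r_path_replace:
  assumes "r_path M d r (a @ p @ b)" "r_path M d r q" "p \<noteq> []" "hd q = hd p" "last q = last p"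
  shows "r_path M d r (a @ q @ b)"
proof -
  have "q \<noteq> []" using assms(2) by (simp add: r_path_def)
  then show ?thesis
    using assms by (cases "a = []"; cases "b = []") (auto simp: r_path_append)
qed

text \<open>An insertion stays an insertion in a longer path, whereas \<open>trivial\<close> turns
  into the duplication of a point.\<close>

lemma r_homotopic_step_context:
  assumes "r_homotopy_step M d r p q" "r_path M d r (a @ p @ b)"
  shows "r_homotopic M d r (a @ p @ b) (a @ q @ b)"
  using assms
proof (induction rule: r_homotopy_step.induct)
  case (insert p q y)
  have "r_path M d r (a @ (p @ y # q) @ b)"
    by (rule r_path_replace[where p = "p @ q"]) (use insert in auto)
  then show ?case
    using insert r_homotopy_step.insert[of "a @ p" "q @ b" M d r y]
    by (intro r_homotopic_step) auto
next
  case (trivial x)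
  then have "0 \<le> r" by (auto simp: r_path_Cons)
  then show ?case
    using r_homotopic_duplicate trivial by simp
qed

lemma r_homotopic_context:
  assumes "r_homotopic M d r p q" "r_path M d r (a @ p @ b)"
  shows "r_homotopic M d r (a @ p @ b) (a @ q @ b)"
  using assms(1)
proof (induction rule: r_homotopic_induct)
  case base
  then show ?case using assms(2) by (rule r_homotopic_refl)
next
  case (step u v)
  have "r_path M d r (a @ u @ b)" using step by (simp add: r_homotopic_def)
  moreover have "r_path M d r v" "u \<noteq> []"
    using step(2) by (meson r_homotopy_step_paths r_path_nonempty)+
  moreover have "hd v = hd u" "last v = last u"
    using step(2) by (metis r_homotopic_step r_homotopic_endpoints)+
  ultimately have "r_path M d r (a @ v @ b)" by (rule r_path_replace[where p = u])
  then show ?case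
    using step \<open>r_path M d r (a @ u @ b)\<close>
    by (meson r_homotopic_step_context r_homotopic_sym r_homotopic_trans)
qed

lemma r_homotopic_concat:
  assumes p: "r_homotopic M d r p p'" and q: "r_homotopic M d r q q'" and "last p = hd q"
  shows "r_homotopic M d r (p @ tl q) (p' @ tl q')"
proof -
  have ne: "p \<noteq> []" "q \<noteq> []" "p' \<noteq> []" "q' \<noteq> []"
    using p q by (auto simp: r_homotopic_def r_path_def)
  have ends: "last p' = hd q" "hd q' = hd q"
    using r_homotopic_endpoints[OF p] r_homotopic_endpoints[OF q] assms(3) by simp_all
  have "r_path M d r (p @ tl q)"
    using p q ne assms(3)
    by (cases q; cases "tl q = []") (auto simp: r_homotopic_def r_path_append r_path_Cons)
  then have 1: "r_homotopic M d r (p @ tl q) (p' @ tl q)"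
    using r_homotopic_context[OF p, of "[]" "tl q"] by simp
  \<comment> \<open>The shared point is moved from the end of \<open>p'\<close> to the front of
    \<open>q\<close>, so that all of \<open>q\<close> appears inside a context.\<close>
  have "p' @ tl q = butlast p' @ q" "p' @ tl q' = butlast p' @ q'"
    using ne ends by (metis append.assoc append_Cons append_Nil append_butlast_last_id
        list.collapse)+
  moreover have "r_path M d r (p' @ tl q)" using 1 by (simp add: r_homotopic_def)
  ultimately have "r_homotopic M d r (p' @ tl q) (p' @ tl q')"
    using r_homotopic_context[OF q, of "butlast p'" "[]"] by simp
  with 1 show ?thesis by (rule r_homotopic_trans)
qed

text \<open>The path is coned off from its first point: the point right after \<open>x\<close> is
  deleted as long as another one follows, which is legal because \<open>x\<close> is within
  \<open>r\<close> of that next point too.\<close>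

lemma r_homotopic_cone:
  assumes "r_path M d r (x # p)" "p \<noteq> []" "\<And>y. y \<in> set p \<Longrightarrow> d x y \<le> r"
  shows "r_homotopic M d r (x # p) [x, last p]"
  using assms
proof (induction p)
  case (Cons y q)
  show ?case
  proof (cases "q = []")
    case True
    then show ?thesis using Cons.prems by (auto intro: r_homotopic_refl)
  next
    case False
    then have "r_path M d r (x # q)"
      using Cons.prems by (auto simp: r_path_Cons)
    moreover from this have "r_homotopic M d r ([x] @ q) ([x] @ y # q)"
      using Cons.prems False by (intro r_homotopic_step r_homotopy_step.insert) auto
    ultimately show ?thesis
      using Cons.IH Cons.prems False r_homotopic_trans[OF r_homotopic_sym] by simp
  qed
qed simp

end

text \<open>An r-loop for \<open>d'\<close> is a \<open>K * r\<close>-loop for \<open>d\<close>,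
  contracts there at some scale \<open>r'\<close>, and this contraction is one at scale
  \<open>K * r'\<close> for \<open>d'\<close>. The bound \<open>1 \<le> K\<close> ensures that the
  final scale is at least \<open>r\<close>.\<close>

lemma coarsely_simply_connected_mono:
  assumes csc: "coarsely_simply_connected M d" and "1 \<le> K"
    and le: "\<And>x y. \<lbrakk>x \<in> M; y \<in> M\<rbrakk> \<Longrightarrow> d x y \<le> K * d' x y"
      "\<And>x y. \<lbrakk>x \<in> M; y \<in> M\<rbrakk> \<Longrightarrow> d' x y \<le> K * d x y"
  shows "coarsely_simply_connected M d'"
proof -
  have le': "d x y \<le> K * r" if "d' x y \<le> r" "x \<in> M" "y \<in> M" for x y r
    using le(1)[of x y] that \<open>1 \<le> K\<close> mult_left_mono[of "d' x y" r K] by linarith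
  have le'': "d' x y \<le> K * r" if "d x y \<le> r" "x \<in> M" "y \<in> M" for x y r
    using le(2)[of x y] that \<open>1 \<le> K\<close> mult_left_mono[of "d x y" r K] by linarith
  have scale: "r \<le> K * r" if "0 \<le> r" for r
    using \<open>1 \<le> K\<close> that mult_right_mono[of 1 K r] by simp
  obtain r where r: "0 \<le> r"
    "\<And>x y. \<lbrakk>x \<in> M; y \<in> M\<rbrakk> \<Longrightarrow> \<exists>p. r_path M d r p \<and> hd p = x \<and> last p = y"
    using csc unfolding coarsely_simply_connected_def coarsely_connected_def by blast
  have "coarsely_connected M d'"
    unfolding coarsely_connected_def
  proof (intro exI[of _ "K * r"] conjI ballI)
    show "0 \<le> K * r" using scale[OF r(1)] r(1) by simp
    fix x y assume "x \<in> M" "y \<in> M"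
    then obtain p where p: "r_path M d r p" "hd p = x" "last p = y" using r(2) by blast
    have "r_path M d' (K * r) p"
      by (rule r_path_mono[OF p(1)]) (auto intro: le'')
    then show "\<exists>p. r_path M d' (K * r) p \<and> hd p = x \<and> last p = y" using p by blast
  qed
  moreover have "\<exists>r'\<ge>r. \<forall>x0 p. r_loop M d' r x0 p \<longrightarrow> r_homotopic M d' r' p [x0, x0]"
    if "0 \<le> r" for r
  proof -
    have "0 \<le> K * r" using scale[OF that] that by simp
    then obtain r' where r': "K * r \<le> r'"
      "\<And>x0 p. r_loop M d (K * r) x0 p \<Longrightarrow> r_homotopic M d r' p [x0, x0]"
      using csc unfolding coarsely_simply_connected_def by blast
    show ?thesis
    proof (intro exI[of _ "K * r'"] conjI allI impI)
      show "r \<le> K * r'" using scale[OF that] scale[of r'] r'(1) that by linarith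
      fix x0 p assume p: "r_loop M d' r x0 p"
      have "r_path M d (K * r) p"
        by (rule r_path_mono[where d = d' and r = r]) (use p in \<open>auto simp: r_loop_def intro: le'\<close>)
      then have "r_homotopic M d r' p [x0, x0]"
        using p by (intro r') (auto simp: r_loop_def)
      then show "r_homotopic M d' (K * r') p [x0, x0]"
        by (rule r_homotopic_mono) (auto intro: le'')
    qed
  qed
  ultimately show ?thesis unfolding coarsely_simply_connected_def by blast
qed

section \<open>Words and paths\<close>

lemma length_free_reduce: "length (free_reduce w) \<le> length w"
proof (induction w)
  case (Cons x w)
  have "length (push_letter x v) \<le> Suc (length v)" for v :: "'a word"
    by (cases v) auto
  from this[of "free_reduce w"] show ?case
    using Cons by (simp add: free_reduce_def)
qed (simp add: free_reduce_def)

lemma free_reduce_closed: "set w \<subseteq> UNIV \<times> S \<Longrightarrow> free_reduce w \<in> carrier (free_group S)"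
  using set_foldr_push[of w "[]"]
  by (auto simp: free_group_def free_reduce_def intro: freely_reduced_foldr)

lemma free_group_letters: "w \<in> carrier (free_group S) \<Longrightarrow> set w \<subseteq> UNIV \<times> S"
  by (simp add: free_group_def)

lemma free_group_reduced: "w \<in> carrier (free_group S) \<Longrightarrow> free_reduce w = w"
  by (simp add: free_group_def free_reduce_id)

lemma free_group_mult: "u \<otimes>\<^bsub>free_group S\<^esub> v = free_reduce (u @ v)"
  by (simp add: free_group_def)

lemma free_group_one: "\<one>\<^bsub>free_group S\<^esub> = []"
  by (simp add: free_group_def)

lemma length_free_group_inv:
  assumes "w \<in> carrier (free_group S)"
  shows "length (inv\<^bsub>free_group S\<^esub> w) = length w"
proof -
  let ?v = "rev (map letter_inv w)"
  have w: "freely_reduced w" "set w \<subseteq> UNIV \<times> S" using assms by (auto simp: free_group_def)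
  then have v: "?v \<in> carrier (free_group S)"
    by (auto simp: free_group_def freely_reduced_rev_inv letter_inv_def)
  have "foldr push_letter ?v w = []"
    using foldr_push_inv[of "[]" w] free_reduce_id[OF w(1)] by (simp add: free_reduce_def)
  then have "?v \<otimes>\<^bsub>free_group S\<^esub> w = \<one>\<^bsub>free_group S\<^esub>"
    using w by (simp add: free_group_mult free_group_one free_reduce_append)
  then have "inv\<^bsub>free_group S\<^esub> w = ?v"
    using group.inv_equality[OF group_free_group _ assms v] by simp
  then show ?thesis by simp
qed

text \<open>The vertices met in the Cayley graph when \<open>w\<close> is read from
  \<open>g\<close>. Letters multiply on the right, in keeping with a left-invariant metric.\<close>

primrec word_path :: "('a, 'b) monoid_scheme \<Rightarrow> 'a \<Rightarrow> 'a word \<Rightarrow> 'a list" where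
  "word_path G g [] = [g]"
| "word_path G g (x # w) = g # word_path G (g \<otimes>\<^bsub>G\<^esub> letter_eval G x) w"

lemma hd_word_path [simp]: "hd (word_path G g w) = g"
  by (cases w) auto

lemma word_path_nonempty [simp]: "word_path G g w \<noteq> []"
  by (cases w) auto

lemma word_eval_Nil [simp]: "word_eval G [] = \<one>\<^bsub>G\<^esub>"
  by (simp add: word_eval_def)

lemma word_eval_Cons [simp]: "word_eval G (x # w) = letter_eval G x \<otimes>\<^bsub>G\<^esub> word_eval G w"
  by (simp add: word_eval_def)

section \<open>The word metric of a generating set and the homotopy of words\<close>

locale generated_group = group G for G (structure) +
  fixes S
  assumes gen_subset: "S \<subseteq> carrier G" and generate_eq: "generate G S = carrier G"
begin

abbreviation d where "d \<equiv> word_metric G S"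

sublocale metric: Metric_space "carrier G" d
  using gen_subset generate_eq by (rule Metric_space_word_metric)

lemma letter_eval_in [simp]: "x \<in> UNIV \<times> S \<Longrightarrow> letter_eval G x \<in> carrier G"
  using gen_subset by (auto simp: letter_eval_def)

lemma word_eval_in [simp]: "set w \<subseteq> UNIV \<times> S \<Longrightarrow> word_eval G w \<in> carrier G"
  by (induction w) auto

lemma word_eval_append:
  "set u \<subseteq> UNIV \<times> S \<Longrightarrow> set v \<subseteq> UNIV \<times> S \<Longrightarrow>
    word_eval G (u @ v) = word_eval G u \<otimes> word_eval G v"
  by (induction u) (auto simp: m_assoc)

lemma word_eval_free_reduce:
  assumes "set w \<subseteq> UNIV \<times> S"
  shows "word_eval G (free_reduce w) = word_eval G w"
proof -
  have "set w \<subseteq> UNIV \<times> carrier G" using assms gen_subset by auto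
  then show ?thesis
    using word_eval_foldr_push[of w "[]"] assms by (simp add: free_reduce_def)
qed

lemma ex_word:
  assumes "g \<in> carrier G"
  shows "\<exists>w. set w \<subseteq> UNIV \<times> S \<and> word_eval G w = g"
proof -
  have "g \<in> generate G S" using assms generate_eq by simp
  then show ?thesis
  proof (induction rule: generate.induct)
    case one
    show ?case by (intro exI[of _ "[]"]) simp
  next
    case (incl h)
    then show ?case
      using gen_subset by (intro exI[of _ "[(True, h)]"]) (auto simp: letter_eval_def)
  next
    case (inv h)
    then show ?case
      using gen_subset by (intro exI[of _ "[(False, h)]"]) (auto simp: letter_eval_def)
  next
    case (eng h1 h2)
    then obtain u v where "set u \<subseteq> UNIV \<times> S" "word_eval G u = h1"
      "set v \<subseteq> UNIV \<times> S" "word_eval G v = h2" by blast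
    then show ?case by (intro exI[of _ "u @ v"]) (simp add: word_eval_append)
  qed
qed

text \<open>The metric counts factors in the group, the free group counts letters. A group element
  can be the value of several letters, so a letter is chosen for each factor; the length stays the
  same.\<close>

lemma word_metric_eq:
  assumes "g \<in> carrier G" "h \<in> carrier G"
  shows "d g h = real (LEAST n. \<exists>w. length w = n \<and> set w \<subseteq> UNIV \<times> S \<and> word_eval G w = inv g \<otimes> h)"
proof -
  have letters: "S \<union> (\<lambda>s. inv s) ` S = letter_eval G ` (UNIV \<times> S)"
    by (force simp: letter_eval_def UNIV_bool)
  have eval: "word_eval G w = foldr (\<otimes>) (map (letter_eval G) w) \<one>" for w
    by (simp add: word_eval_def foldr_map comp_def)
  have "(\<exists>xs. length xs = n \<and> set xs \<subseteq> S \<union> (\<lambda>s. inv s) ` S \<and> foldr (\<otimes>) xs \<one> = x) \<longleftrightarrow>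
      (\<exists>w. length w = n \<and> set w \<subseteq> UNIV \<times> S \<and> word_eval G w = x)" for n x
  proof
    assume "\<exists>xs. length xs = n \<and> set xs \<subseteq> S \<union> (\<lambda>s. inv s) ` S \<and> foldr (\<otimes>) xs \<one> = x"
    then obtain xs where xs: "length xs = n" "foldr (\<otimes>) xs \<one> = x"
      "xs \<in> lists (letter_eval G ` (UNIV \<times> S))"
      unfolding letters by blast
    then obtain w where "xs = map (letter_eval G) w" "w \<in> lists (UNIV \<times> S)"
      unfolding lists_image by blast
    then show "\<exists>w. length w = n \<and> set w \<subseteq> UNIV \<times> S \<and> word_eval G w = x"
      using xs by (intro exI[of _ w]) (auto simp: eval)
  next
    assume "\<exists>w. length w = n \<and> set w \<subseteq> UNIV \<times> S \<and> word_eval G w = x"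
    then obtain w where "length w = n" "set w \<subseteq> UNIV \<times> S" "word_eval G w = x" by blast
    then show "\<exists>xs. length xs = n \<and> set xs \<subseteq> S \<union> (\<lambda>s. inv s) ` S \<and> foldr (\<otimes>) xs \<one> = x"
      unfolding letters by (intro exI[of _ "map (letter_eval G) w"]) (auto simp: eval)
  qed
  then show ?thesis using assms by (simp add: word_metric_def)
qed

lemma geodesic_word:
  assumes "g \<in> carrier G" "h \<in> carrier G"
  obtains w where "set w \<subseteq> UNIV \<times> S" "word_eval G w = inv g \<otimes> h" "real (length w) = d g h"
proof -
  have "\<exists>n w. length w = n \<and> set w \<subseteq> UNIV \<times> S \<and> word_eval G w = inv g \<otimes> h"
    using ex_word[of "inv g \<otimes> h"] assms by auto
  from LeastI_ex[OF this] show ?thesis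
    by (elim exE conjE) (rule that, simp_all add: word_metric_eq[OF assms])
qed

lemma word_metric_le_length:
  assumes "g \<in> carrier G" "set w \<subseteq> UNIV \<times> S"
  shows "d g (g \<otimes> word_eval G w) \<le> length w"
proof -
  have "inv g \<otimes> (g \<otimes> word_eval G w) = word_eval G w"
    using assms by (simp add: m_assoc[symmetric])
  then show ?thesis
    using assms by (auto simp: word_metric_eq intro!: Least_le)
qed

lemma last_word_path:
  "g \<in> carrier G \<Longrightarrow> set w \<subseteq> UNIV \<times> S \<Longrightarrow> last (word_path G g w) = g \<otimes> word_eval G w"
  by (induction w arbitrary: g) (auto simp: m_assoc)

lemma word_path_append:
  assumes "g \<in> carrier G" "set u \<subseteq> UNIV \<times> S" "set v \<subseteq> UNIV \<times> S"
  shows "word_path G g (u @ v) = word_path G g u @ tl (word_path G (g \<otimes> word_eval G u) v)"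
  using assms
proof (induction u arbitrary: g)
  case Nil
  then show ?case by (cases v) auto
qed (auto simp: m_assoc)

lemma word_metric_letter:
  "g \<in> carrier G \<Longrightarrow> x \<in> UNIV \<times> S \<Longrightarrow> d g (g \<otimes> letter_eval G x) \<le> 1"
  using word_metric_le_length[of g "[x]"] by simp

lemma r_path_word_path:
  "g \<in> carrier G \<Longrightarrow> set w \<subseteq> UNIV \<times> S \<Longrightarrow> 1 \<le> k \<Longrightarrow> r_path (carrier G) d k (word_path G g w)"
proof (induction w arbitrary: g)
  case (Cons x w)
  then show ?case using word_metric_letter[of g x] by (auto simp: r_path_Cons)
qed simp

lemma word_path_dist:
  "g \<in> carrier G \<Longrightarrow> set w \<subseteq> UNIV \<times> S \<Longrightarrow> y \<in> set (word_path G g w) \<Longrightarrow> d g y \<le> length w"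
proof (induction w arbitrary: g)
  case (Cons x w)
  let ?g = "g \<otimes> letter_eval G x"
  show ?case
  proof (cases "y = g")
    case False
    then have y: "y \<in> set (word_path G ?g w)" using Cons.prems by simp
    moreover from this have "y \<in> carrier G"
      using r_path_word_path[of ?g w 1] Cons.prems by (auto simp: r_path_def)
    ultimately show ?thesis
      using Cons.IH[of ?g] Cons.prems word_metric_letter[of g x] metric.triangle[of g ?g y] by auto
  qed (use Cons.prems in auto)
qed simp

text \<open>All starting points are quantified over because, in a concatenation, the second word is
  read from wherever the first one ends.\<close>

definition word_homotopic where
  "word_homotopic k u v \<longleftrightarrow> set u \<subseteq> UNIV \<times> S \<and> set v \<subseteq> UNIV \<times> S \<and>
    (\<forall>g\<in>carrier G. r_homotopic (carrier G) d k (word_path G g u) (word_path G g v))"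

lemma word_homotopic_refl: "1 \<le> k \<Longrightarrow> set u \<subseteq> UNIV \<times> S \<Longrightarrow> word_homotopic k u u"
  by (simp add: word_homotopic_def r_homotopic_refl r_path_word_path)

lemma word_homotopic_sym: "word_homotopic k u v \<Longrightarrow> word_homotopic k v u"
  by (auto simp: word_homotopic_def intro: r_homotopic_sym)

lemma word_homotopic_trans [trans]:
  "word_homotopic k u v \<Longrightarrow> word_homotopic k v w \<Longrightarrow> word_homotopic k u w"
  by (auto simp: word_homotopic_def intro: r_homotopic_trans)

lemma word_homotopic_append:
  assumes u: "word_homotopic k u u'" and v: "word_homotopic k v v'"
  shows "word_homotopic k (u @ v) (u' @ v')"
proof -
  have sets: "set u \<subseteq> UNIV \<times> S" "set u' \<subseteq> UNIV \<times> S" "set v \<subseteq> UNIV \<times> S" "set v' \<subseteq> UNIV \<times> S"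
    using u v by (auto simp: word_homotopic_def)
  have "r_homotopic (carrier G) d k (word_path G g (u @ v)) (word_path G g (u' @ v'))"
    if g: "g \<in> carrier G" for g
  proof -
    have 1: "r_homotopic (carrier G) d k (word_path G g u) (word_path G g u')"
      using u g by (simp add: word_homotopic_def)
    let ?h = "g \<otimes> word_eval G u"
    \<comment> \<open>Homotopies fix endpoints, so \<open>v\<close> and \<open>v'\<close> are read
      from the same point.\<close>
    have h: "g \<otimes> word_eval G u' = ?h"
      using r_homotopic_endpoints[OF 1] g sets by (simp add: last_word_path)
    have 2: "r_homotopic (carrier G) d k (word_path G ?h v) (word_path G ?h v')"
      using v g sets by (simp add: word_homotopic_def)
    show ?thesis
      using metric.r_homotopic_concat[OF 1 2] g sets h by (simp add: word_path_append last_word_path)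
  qed
  then show ?thesis using sets by (simp add: word_homotopic_def)
qed

lemma r_homotopic_const:
  assumes "g \<in> carrier G" "0 \<le> k"
  shows "r_homotopic (carrier G) d k [g] [g, g]"
  using metric.r_homotopic_duplicate[of k "[]" g "[]"] assms by simp

text \<open>No vertex of a loop of length at most \<open>k\<close> is farther than \<open>k\<close>
  from its start, so the cone from the start contracts the loop.\<close>

lemma short_loop_word_homotopic:
  assumes "1 \<le> k" "real (length w) \<le> k" "set w \<subseteq> UNIV \<times> S" "word_eval G w = \<one>"
  shows "word_homotopic k w []"
proof (cases w)
  case Nil
  then show ?thesis using assms by (simp add: word_homotopic_refl)
next
  case (Cons x v)
  have "r_homotopic (carrier G) d k (word_path G g w) [g]" if g: "g \<in> carrier G" for g
  proof -
    let ?p = "word_path G (g \<otimes> letter_eval G x) v"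
    have p: "word_path G g w = g # ?p" using Cons by simp
    have "last ?p = g"
      using last_word_path[OF g assms(3)] g assms(4) unfolding p by simp
    moreover have "r_path (carrier G) d k (g # ?p)"
      using r_path_word_path[OF g assms(3,1)] p by simp
    moreover have "d g y \<le> k" if "y \<in> set ?p" for y
      using word_path_dist[OF g assms(3), of y] that assms(2) p by simp
    ultimately have "r_homotopic (carrier G) d k (word_path G g w) [g, g]"
      using metric.r_homotopic_cone[of k g ?p] p by simp
    also have "r_homotopic (carrier G) d k [g, g] [g]"
      using r_homotopic_const[OF g] assms(1) by (simp add: r_homotopic_sym)
    finally show ?thesis .
  qed
  then show ?thesis using assms by (simp add: word_homotopic_def)
qed

text \<open>A cancelling pair of letters spells a loop of length 2; this is the origin of the bound
  \<open>2 \<le> k\<close>.\<close>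

lemma word_homotopic_push:
  assumes "2 \<le> k" "x \<in> UNIV \<times> S" "set w \<subseteq> UNIV \<times> S"
  shows "word_homotopic k (x # w) (push_letter x w)"
proof (cases "\<exists>v. w = letter_inv x # v")
  case True
  then obtain v where w: "w = letter_inv x # v" by blast
  have "word_homotopic k [x, letter_inv x] []"
    using assms gen_subset w
    by (intro short_loop_word_homotopic) (auto simp: letter_eval_def letter_inv_def)
  from word_homotopic_append[OF this word_homotopic_refl, of v] show ?thesis
    using assms w by simp
next
  case False
  then have "push_letter x w = x # w" by (cases w) auto
  then show ?thesis using assms by (simp add: word_homotopic_refl)
qed

lemma word_homotopic_free_reduce:
  assumes "2 \<le> k" "set w \<subseteq> UNIV \<times> S"
  shows "word_homotopic k w (free_reduce w)"
  using assms(2)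
proof (induction w)
  case Nil
  then show ?case using assms(1) by (simp add: word_homotopic_refl free_reduce_def)
next
  case (Cons x w)
  have "word_homotopic k ([x] @ w) ([x] @ free_reduce w)"
    using Cons assms(1) by (intro word_homotopic_append word_homotopic_refl) auto
  also have "word_homotopic k ([x] @ free_reduce w) (push_letter x (free_reduce w))"
    using word_homotopic_push[of k x "free_reduce w"] Cons.prems assms(1)
      free_group_letters[OF free_reduce_closed, of w S] by simp
  finally show ?case by (simp add: free_reduce_def)
qed

text \<open>Up to homotopy, multiplication in the free group is concatenation, and concatenation
  respects homotopy. In a conjugate, the middle word may then be erased, after which the outer two
  cancel.\<close>

lemma normal_null_homotopic_words:
  assumes "2 \<le> k"
  shows "{w \<in> carrier (free_group S). word_homotopic k w []} \<lhd> free_group S" (is "?N \<lhd> ?F")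
proof -
  interpret F: group ?F by (rule group_free_group)
  have mult: "word_homotopic k (u \<otimes>\<^bsub>?F\<^esub> v) (u @ v)" if "u \<in> carrier ?F" "v \<in> carrier ?F" for u v
    using word_homotopic_free_reduce[OF assms, of "u @ v"] that
    by (simp add: free_group_mult free_group_letters word_homotopic_sym)
  have refl: "word_homotopic k u u" if "u \<in> carrier ?F" for u
    using assms that by (intro word_homotopic_refl free_group_letters) auto
  have inv: "word_homotopic k (inv\<^bsub>?F\<^esub> u) []" if u: "u \<in> ?N" for u
  proof -
    \<comment> \<open>The null-homotopic \<open>u\<close> is appended to its inverse, and the result
      cancels.\<close>
    have "word_homotopic k (inv\<^bsub>?F\<^esub> u @ []) (inv\<^bsub>?F\<^esub> u @ u)"
      using u by (intro word_homotopic_append refl word_homotopic_sym[of k u]) auto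
    also have "word_homotopic k (inv\<^bsub>?F\<^esub> u @ u) (inv\<^bsub>?F\<^esub> u \<otimes>\<^bsub>?F\<^esub> u)"
      using u by (intro word_homotopic_sym[OF mult]) auto
    finally show ?thesis using u by (simp add: free_group_one)
  qed
  have "subgroup ?N ?F"
  proof (rule F.subgroupI)
    have "\<one>\<^bsub>?F\<^esub> \<in> ?N" using refl[OF F.one_closed] F.one_closed by (simp add: free_group_one)
    then show "?N \<noteq> {}" by blast
    fix u v assume uv: "u \<in> ?N" "v \<in> ?N"
    have "word_homotopic k (u \<otimes>\<^bsub>?F\<^esub> v) (u @ v)" using uv mult by simp
    also have "word_homotopic k (u @ v) ([] @ [])"
      using uv by (intro word_homotopic_append) auto
    finally show "u \<otimes>\<^bsub>?F\<^esub> v \<in> ?N" using uv by simp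
  qed (use inv in auto)
  moreover have "h \<otimes>\<^bsub>?F\<^esub> u \<otimes>\<^bsub>?F\<^esub> inv\<^bsub>?F\<^esub> h \<in> ?N"
    if h: "h \<in> carrier ?F" and u: "u \<in> ?N" for h u
  proof -
    have "word_homotopic k (h \<otimes>\<^bsub>?F\<^esub> u \<otimes>\<^bsub>?F\<^esub> inv\<^bsub>?F\<^esub> h) ((h \<otimes>\<^bsub>?F\<^esub> u) @ inv\<^bsub>?F\<^esub> h)"
      using h u by (intro mult) auto
    also have "word_homotopic k \<dots> ((h @ u) @ inv\<^bsub>?F\<^esub> h)"
      using h u by (intro word_homotopic_append refl mult) auto
    also have "word_homotopic k \<dots> ((h @ []) @ inv\<^bsub>?F\<^esub> h)"
      using h u by (intro word_homotopic_append refl) auto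
    also have "word_homotopic k \<dots> (h \<otimes>\<^bsub>?F\<^esub> inv\<^bsub>?F\<^esub> h)"
      using h mult[of h "inv\<^bsub>?F\<^esub> h"] by (simp add: word_homotopic_sym)
    finally show ?thesis using h u by (simp add: free_group_one)
  qed
  ultimately show ?thesis by (auto simp: F.normal_inv_iff)
qed

text \<open>Each jump of length at most \<open>k\<close> is replaced by a geodesic word. The
  geodesic stays within \<open>k\<close> of its start, so the cone collapses it back to the
  jump.\<close>

lemma r_path_homotopic_word_path:
  assumes "r_path (carrier G) d k p" "1 \<le> k"
  shows "\<exists>w. set w \<subseteq> UNIV \<times> S \<and> r_homotopic (carrier G) d k p (word_path G (hd p) w)"
  using assms(1)
proof (induction p)
  case (Cons x p)
  have x: "x \<in> carrier G" using Cons.prems by (simp add: r_path_Cons)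
  show ?case
  proof (cases "p = []")
    case True
    then show ?thesis using x by (intro exI[of _ "[]"]) (simp add: r_homotopic_refl)
  next
    case False
    let ?y = "hd p"
    have p: "r_path (carrier G) d k p" and xy: "d x ?y \<le> k"
      using Cons.prems False by (auto simp: r_path_Cons)
    then have y: "?y \<in> carrier G" using False by (auto simp: r_path_def)
    obtain v where v: "set v \<subseteq> UNIV \<times> S" "r_homotopic (carrier G) d k p (word_path G ?y v)"
      using Cons.IH p by blast
    obtain u where u: "set u \<subseteq> UNIV \<times> S" "word_eval G u = inv x \<otimes> ?y" "real (length u) = d x ?y"
      using geodesic_word[OF x y] .
    have end_u: "x \<otimes> word_eval G u = ?y"
      using x y u(2) by (simp add: m_assoc[symmetric])
    have "r_homotopic (carrier G) d k (word_path G x u) [x, ?y]"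
    proof (cases u)
      case Nil
      then have "?y = x" using end_u x by simp
      then show ?thesis using Nil r_homotopic_const[OF x] assms(2) by simp
    next
      case (Cons a u')
      let ?q = "word_path G (x \<otimes> letter_eval G a) u'"
      have q: "word_path G x u = x # ?q" using Cons by simp
      have "last ?q = ?y"
        using last_word_path[OF x u(1)] end_u unfolding q by simp
      moreover have "r_path (carrier G) d k (x # ?q)"
        using r_path_word_path[OF x u(1) assms(2)] q by simp
      moreover have "d x z \<le> k" if "z \<in> set ?q" for z
        using word_path_dist[OF x u(1), of z] that u(3) xy q by simp
      ultimately show ?thesis
        using metric.r_homotopic_cone[of k x ?q] q by simp
    qed
    from metric.r_homotopic_concat[OF r_homotopic_sym[OF this] v(2)]
    have "r_homotopic (carrier G) d k ([x, ?y] @ tl p) (word_path G x u @ tl (word_path G ?y v))"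
      by simp
    moreover have "[x, ?y] @ tl p = x # p" using False by simp
    ultimately show ?thesis
      using word_path_append[OF x u(1) v(1)] end_u u v by (intro exI[of _ "u @ v"]) auto
  qed
qed (simp add: r_path_def)

lemma coarsely_connected_word_metric: "coarsely_connected (carrier G) d"
  unfolding coarsely_connected_def
proof (intro exI[of _ 1] conjI ballI)
  fix x y assume xy: "x \<in> carrier G" "y \<in> carrier G"
  then obtain w where w: "set w \<subseteq> UNIV \<times> S" "word_eval G w = inv x \<otimes> y"
    using ex_word[of "inv x \<otimes> y"] by auto
  have "x \<otimes> word_eval G w = y" using xy w by (simp add: m_assoc[symmetric])
  then show "\<exists>p. r_path (carrier G) d 1 p \<and> hd p = x \<and> last p = y"
    using xy w by (intro exI[of _ "word_path G x w"]) (simp add: r_path_word_path last_word_path)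
qed simp

lemma boundedly_presented_imp_coarsely_simply_connected:
  assumes "boundedly_presented G S"
  shows "coarsely_simply_connected (carrier G) d"
  unfolding coarsely_simply_connected_def
proof (intro conjI coarsely_connected_word_metric allI impI)
  let ?F = "free_group S"
  obtain R n where R: "has_presentation G S R" and n: "\<And>r. r \<in> R \<Longrightarrow> length r \<le> n"
    using assms unfolding boundedly_presented_def by blast
  fix r :: real assume "0 \<le> r"
  \<comment> \<open>At scale \<open>k\<close>, r-loops are still paths, relators contract as short
    loops, and free reduction is a homotopy.\<close>
  define k where "k = max r (max (real n) 2)"
  have k: "r \<le> k" "real n \<le> k" "2 \<le> k" by (auto simp: k_def)
  let ?N = "{w \<in> carrier ?F. word_homotopic k w []}"
  have kernel: "kernel ?F G (word_eval G) = normal_closure ?F R" and RF: "R \<subseteq> carrier ?F"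
    using R by (auto simp: has_presentation_def)
  have "word_homotopic k w []" if "w \<in> R" for w
  proof (rule short_loop_word_homotopic)
    have "w \<in> kernel ?F G (word_eval G)"
      using that unfolding kernel normal_closure_def by blast
    then show "word_eval G w = \<one>" by (simp add: kernel_def)
  qed (use that n[OF that] k RF free_group_letters in auto)
  then have "R \<subseteq> ?N" using RF by blast
  then have "kernel ?F G (word_eval G) \<subseteq> ?N"
    using normal_null_homotopic_words[OF k(3)] unfolding kernel normal_closure_def by blast
  \<comment> \<open>The words obtained from loops need not be reduced, so the statement about the
    kernel is extended to all words of value \<open>\<one>\<close>.\<close>
  then have null: "word_homotopic k w []" if "set w \<subseteq> UNIV \<times> S" "word_eval G w = \<one>" for w
  proof -
    have "free_reduce w \<in> kernel ?F G (word_eval G)"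
      using that by (simp add: kernel_def free_reduce_closed word_eval_free_reduce)
    then have "word_homotopic k (free_reduce w) []"
      using \<open>kernel ?F G (word_eval G) \<subseteq> ?N\<close> by blast
    then show ?thesis
      using word_homotopic_free_reduce[OF k(3) that(1)] word_homotopic_trans by blast
  qed
  show "\<exists>r'\<ge>r. \<forall>x0 p. r_loop (carrier G) d r x0 p \<longrightarrow> r_homotopic (carrier G) d r' p [x0, x0]"
  proof (intro exI[of _ k] conjI allI impI k(1))
    fix x p assume "r_loop (carrier G) d r x p"
    then have p: "r_path (carrier G) d r p" "hd p = x" "last p = x" by (auto simp: r_loop_def)
    then have x: "x \<in> carrier G" by (auto simp: r_path_def)
    have "r_path (carrier G) d k p" by (rule r_path_mono[OF p(1)]) (use k in auto)
    then obtain w where w: "set w \<subseteq> UNIV \<times> S"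
      and hom: "r_homotopic (carrier G) d k p (word_path G x w)"
      using r_path_homotopic_word_path[of k p] k(3) p(2) by auto
    have "x \<otimes> word_eval G w = x"
      using conjunct2[OF r_homotopic_endpoints[OF hom]] p(3) by (simp add: last_word_path x w)
    then have "word_eval G w = \<one>" using x w by simp
    then have "r_homotopic (carrier G) d k (word_path G x w) [x]"
      using null[OF w] x by (simp add: word_homotopic_def)
    also have "r_homotopic (carrier G) d k [x] [x, x]"
      using r_homotopic_const[OF x] k(3) by simp
    finally show "r_homotopic (carrier G) d k p [x, x]" using hom r_homotopic_trans by blast
  qed
qed

end

section \<open>Relators from coarse homotopies\<close>

text \<open>The holonomy of a labelling of edges by elements of \<open>Q\<close>; a path without
  edges has holonomy one.\<close>

fun path_product :: "('g, 'c) monoid_scheme \<Rightarrow> ('a \<Rightarrow> 'a \<Rightarrow> 'g) \<Rightarrow> 'a list \<Rightarrow> 'g" where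
  "path_product Q f (x # y # p) = f x y \<otimes>\<^bsub>Q\<^esub> path_product Q f (y # p)"
| "path_product Q f _ = \<one>\<^bsub>Q\<^esub>"

context group
begin

lemma path_product_closed:
  assumes "\<And>x y. x \<in> M \<Longrightarrow> y \<in> M \<Longrightarrow> f x y \<in> carrier G"
  shows "set p \<subseteq> M \<Longrightarrow> path_product G f p \<in> carrier G"
  by (induction p rule: induct_list012) (auto simp: assms)

lemma path_product_append:
  assumes f: "\<And>x y. x \<in> M \<Longrightarrow> y \<in> M \<Longrightarrow> f x y \<in> carrier G"
    and "p \<noteq> []" "set p \<subseteq> M" "set (y # q) \<subseteq> M"
  shows "path_product G f (p @ y # q) =
    path_product G f p \<otimes> (f (last p) y \<otimes> path_product G f (y # q))"
  using assms(2,3)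
proof (induction p rule: induct_list012)
  case (2 x)
  then show ?case
    using path_product_closed[where M = M and f = f, OF f assms(4)] assms(4) f by simp
next
  case (3 x z p)
  have "last (z # p) \<in> set (z # p)" by (rule last_in_set) simp
  then have "last (z # p) \<in> M" using 3(4) by auto
  then show ?case
    using 3 path_product_closed[where M = M and f = f, OF f assms(4)] f assms(4)
      path_product_closed[where M = M and f = f, OF f, of "z # p"]
    by (simp add: m_assoc)
qed simp

text \<open>Inserting \<open>y\<close> between \<open>x\<close> and \<open>z\<close> replaces the
  factor \<open>f x z\<close> by \<open>f x y \<otimes> f y z\<close>. These agree by the cocycle
  relation, which is asked only of triangles with all sides at most \<open>r\<close>, the only ones
  that an r-homotopy uses.\<close>

lemma path_product_r_homotopic:
  assumes f: "\<And>x y. x \<in> M \<Longrightarrow> y \<in> M \<Longrightarrow> f x y \<in> carrier G"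
    and cocycle: "\<And>x y z. \<lbrakk>x \<in> M; y \<in> M; z \<in> M; d x y \<le> r; d y z \<le> r; d x z \<le> r\<rbrakk>
      \<Longrightarrow> f x y \<otimes> f y z = f x z"
    and "r_homotopic M d r p q"
  shows "path_product G f p = path_product G f q"
proof -
  have step: "path_product G f u = path_product G f v" if "r_homotopy_step M d r u v" for u v
    using that
  proof (induction rule: r_homotopy_step.induct)
    case (insert p q y)
    then obtain z q' where q: "q = z # q'" by (cases q) auto
    have sets: "set p \<subseteq> M" "y \<in> M" "set (z # q') \<subseteq> M" "last p \<in> M"
      using insert q last_in_set[of p] by (auto simp: r_path_def)
    have "d (last p) z \<le> r" "d (last p) y \<le> r" "d y z \<le> r"
      using insert q by (auto simp: r_path_append r_path_Cons)
    then have "f (last p) z = f (last p) y \<otimes> f y z"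
      using sets cocycle by simp
    moreover have "path_product G f (z # q') \<in> carrier G"
      using path_product_closed[where M = M and f = f, OF f] sets by simp
    ultimately show ?case
      using sets insert(1) f q path_product_append[where M = M and f = f, OF f insert(1), of z q']
        path_product_append[where M = M and f = f, OF f insert(1), of y "z # q'"]
      by (simp add: m_assoc)
  next
    case (trivial x)
    then have "x \<in> M" "d x x \<le> r" by (auto simp: r_path_Cons)
    \<comment> \<open>The degenerate triangle makes \<open>f x x\<close> idempotent, and the only
      idempotent of a group is \<open>\<one>\<close>.\<close>
    then have "f x x \<otimes> f x x = f x x" "f x x \<in> carrier G" using cocycle f by auto
    then show ?case by simp
  qed
  from assms(3) show ?thesis
    by (induction rule: r_homotopic_induct) (auto dest: step)
qed

end

section \<open>From coarse simple connectedness to a bounded presentation\<close>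

context generated_group
begin

lemma group_hom_word_eval: "group_hom (free_group S) G (word_eval G)"
  using group_free_group word_eval_hom[OF gen_subset]
  by (simp add: group_hom_def group_hom_axioms_def is_group)

text \<open>Choosing a geodesic word for each pair of points turns a path into a word. Modulo the short
  relators, subdividing a triangle does not change that word, so it is a homotopy invariant.\<close>

lemma short_relators_generate_kernel:
  assumes "1 \<le> k"
    and loops: "\<And>x p. r_loop (carrier G) d 1 x p \<Longrightarrow> r_homotopic (carrier G) d k p [x, x]"
    and N: "N \<lhd> free_group S"
    and short: "\<And>w. \<lbrakk>w \<in> kernel (free_group S) G (word_eval G); length w \<le> 3 * nat \<lfloor>k\<rfloor>\<rbrakk> \<Longrightarrow> w \<in> N"
  shows "kernel (free_group S) G (word_eval G) \<subseteq> N"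
proof
  let ?F = "free_group S" and ?Q = "free_group S Mod N"
  interpret F: group ?F by (rule group_free_group)
  interpret N: normal N ?F by (rule N)
  interpret Q: group ?Q by (rule N.factorgroup_is_group)
  interpret ev: group_hom ?F G "word_eval G" by (rule group_hom_word_eval)
  define \<phi> where "\<phi> u = N #>\<^bsub>?F\<^esub> u" for u
  interpret \<phi>: group_hom ?F ?Q \<phi>
    using N.r_coset_hom_Mod by unfold_locales (simp add: \<phi>_def[abs_def])
  \<comment> \<open>The quotient of two short words with equal value is a short element of the
    kernel, hence lies in \<open>N\<close>.\<close>
  have \<phi>_eq: "\<phi> u = \<phi> v" if "u \<in> carrier ?F" "v \<in> carrier ?F" "word_eval G u = word_eval G v"
    "length u + length v \<le> 3 * nat \<lfloor>k\<rfloor>" for u v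
  proof -
    let ?w = "u \<otimes>\<^bsub>?F\<^esub> inv\<^bsub>?F\<^esub> v"
    have "length ?w \<le> length u + length v"
      using length_free_reduce[of "u @ inv\<^bsub>?F\<^esub> v"] length_free_group_inv[OF that(2)]
      by (simp add: free_group_mult)
    moreover have "?w \<in> kernel ?F G (word_eval G)"
      using that by (simp add: kernel_def)
    ultimately have "?w \<in> N" using short that(4) by simp
    then have "N #>\<^bsub>?F\<^esub> ?w = N"
      using that by (intro F.coset_join2 N.subgroup_axioms) auto
    then show ?thesis
      using that F.coset_mult_inv1 N.subset unfolding \<phi>_def by blast
  qed
  have "\<exists>w. w \<in> carrier ?F \<and> word_eval G w = inv x \<otimes> y \<and> real (length w) \<le> d x y"
    if xy: "x \<in> carrier G" "y \<in> carrier G" for x y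
  proof -
    obtain w where w: "set w \<subseteq> UNIV \<times> S" "word_eval G w = inv x \<otimes> y" "real (length w) = d x y"
      using geodesic_word[OF xy] .
    then show ?thesis
      using length_free_reduce[of w]
      by (intro exI[of _ "free_reduce w"]) (simp add: free_reduce_closed word_eval_free_reduce)
  qed
  then obtain c where c: "\<And>x y. \<lbrakk>x \<in> carrier G; y \<in> carrier G\<rbrakk> \<Longrightarrow> c x y \<in> carrier ?F"
      "\<And>x y. \<lbrakk>x \<in> carrier G; y \<in> carrier G\<rbrakk> \<Longrightarrow> word_eval G (c x y) = inv x \<otimes> y"
      "\<And>x y. \<lbrakk>x \<in> carrier G; y \<in> carrier G\<rbrakk> \<Longrightarrow> real (length (c x y)) \<le> d x y"
    by metis
  define f where "f x y = \<phi> (c x y)" for x y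
  have f: "f x y \<in> carrier ?Q" if "x \<in> carrier G" "y \<in> carrier G" for x y
    unfolding f_def using c(1)[OF that] by (rule \<phi>.hom_closed)
  have c_short: "length (c x y) \<le> nat \<lfloor>k\<rfloor>" if "x \<in> carrier G" "y \<in> carrier G" "d x y \<le> k" for x y
    using c(3)[OF that(1,2)] that(3) by (intro le_nat_floor) simp
  have cocycle: "f x y \<otimes>\<^bsub>?Q\<^esub> f y z = f x z"
    if "x \<in> carrier G" "y \<in> carrier G" "z \<in> carrier G" "d x y \<le> k" "d y z \<le> k" "d x z \<le> k" for x y z
  proof -
    have "inv x \<otimes> y \<otimes> (inv y \<otimes> z) = inv x \<otimes> z"
      using that by (metis inv_closed inv_solve_left m_assoc m_closed)
    \<comment> \<open>Word lengths are integers, so each of the three sides contributes at most the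
      integer part of \<open>k\<close>.\<close>
    moreover have "length (c x y \<otimes>\<^bsub>?F\<^esub> c y z) + length (c x z) \<le> 3 * nat \<lfloor>k\<rfloor>"
      using that length_free_reduce[of "c x y @ c y z"] c_short[of x y] c_short[of y z] c_short[of x z]
      by (simp add: free_group_mult)
    ultimately have "\<phi> (c x y \<otimes>\<^bsub>?F\<^esub> c y z) = \<phi> (c x z)"
      using that c by (intro \<phi>_eq) auto
    then show ?thesis using that c(1) by (simp add: f_def)
  qed
  have product: "path_product ?Q f (word_path G g w) = \<phi> (free_reduce w)"
    if "g \<in> carrier G" "set w \<subseteq> UNIV \<times> S" for g w
    using that
  proof (induction w arbitrary: g)
    case Nil
    then show ?case using \<phi>.hom_one by (simp add: free_reduce_def free_group_one)
  next
    case (Cons x w)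
    let ?h = "g \<otimes> letter_eval G x"
    have x: "[x] \<in> carrier ?F" using Cons.prems by (auto simp: free_group_def freely_reduced_def)
    have h: "?h \<in> carrier G" using Cons.prems by simp
    \<comment> \<open>The word chosen for this edge can differ from the letter read: two letters may
      have the same value, and the value may be \<open>\<one>\<close>. Both words have length at
      most 1, so they agree modulo \<open>N\<close>.\<close>
    have "d g ?h \<le> 1" using Cons.prems word_metric_letter by simp
    then have "real (length (c g ?h)) \<le> 1" using c(3)[of g ?h] Cons.prems h by linarith
    moreover have "1 \<le> nat \<lfloor>k\<rfloor>" using \<open>1 \<le> k\<close> by linarith
    ultimately have "\<phi> (c g ?h) = \<phi> [x]"
      using Cons.prems c(1,2)[of g ?h] x h by (intro \<phi>_eq) (auto simp: m_assoc[symmetric])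
    moreover obtain p where p: "word_path G ?h w = ?h # p"
      using hd_word_path word_path_nonempty by (metis list.collapse)
    have "path_product ?Q f (word_path G g (x # w)) =
        f g ?h \<otimes>\<^bsub>?Q\<^esub> path_product ?Q f (word_path G ?h w)"
      using p by simp
    moreover have "path_product ?Q f (word_path G ?h w) = \<phi> (free_reduce w)"
      using Cons.IH[OF h] Cons.prems by simp
    moreover have "free_reduce w \<in> carrier ?F"
      using Cons.prems by (intro free_reduce_closed) simp
    ultimately have "path_product ?Q f (word_path G g (x # w)) = \<phi> ([x] \<otimes>\<^bsub>?F\<^esub> free_reduce w)"
      using x by (simp add: f_def)
    moreover have "[x] \<otimes>\<^bsub>?F\<^esub> free_reduce w = free_reduce (x # w)"
      using \<open>free_reduce w \<in> carrier ?F\<close> free_reduce_append[of "free_reduce w" "[x]"]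
      by (simp add: free_group_def free_reduce_def)
    ultimately show ?case by simp
  qed
  fix w assume w: "w \<in> kernel ?F G (word_eval G)"
  then have wF: "w \<in> carrier ?F" "word_eval G w = \<one>" by (auto simp: kernel_def)
  have letters: "set w \<subseteq> UNIV \<times> S" using wF(1) by (rule free_group_letters)
  have "r_loop (carrier G) d 1 \<one> (word_path G \<one> w)"
    using letters wF(2) by (simp add: r_loop_def r_path_word_path last_word_path)
  then have "r_homotopic (carrier G) d k (word_path G \<one> w) [\<one>, \<one>]" by (rule loops)
  also have "r_homotopic (carrier G) d k [\<one>, \<one>] (word_path G \<one> [])"
    using r_homotopic_const[of \<one> k] \<open>1 \<le> k\<close> by (simp add: r_homotopic_sym)
  \<comment> \<open>The left side is the class of \<open>w\<close> modulo \<open>N\<close>, the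
    right side is the class of the empty word.\<close>
  finally have "path_product ?Q f (word_path G \<one> w) = path_product ?Q f (word_path G \<one> [])"
    by (intro Q.path_product_r_homotopic[where M = "carrier G" and d = d and r = k] f cocycle)
  then have "\<phi> w = \<one>\<^bsub>?Q\<^esub>"
    using product[of \<one> w] letters wF(1) by (simp add: free_group_reduced)
  then have "N #>\<^bsub>?F\<^esub> w = N" by (simp add: \<phi>_def FactGroup_def)
  then show "w \<in> N"
    using F.coset_join1[OF _ wF(1) N.subgroup_axioms] by blast
qed

lemma coarsely_simply_connected_imp_boundedly_presented:
  assumes "coarsely_simply_connected (carrier G) d"
  shows "boundedly_presented G S"
proof -
  let ?F = "free_group S"
  let ?K = "kernel ?F G (word_eval G)"
  interpret ev: group_hom ?F G "word_eval G" by (rule group_hom_word_eval)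
  have "(0::real) \<le> 1" by simp
  with assms obtain k where k: "1 \<le> k"
    "\<And>x p. r_loop (carrier G) d 1 x p \<Longrightarrow> r_homotopic (carrier G) d k p [x, x]"
    unfolding coarsely_simply_connected_def by blast
  \<comment> \<open>Taking every short element of the kernel as a relator makes the length bound
    immediate and leaves only the generation of the kernel.\<close>
  define R where "R = {w \<in> ?K. length w \<le> 3 * nat \<lfloor>k\<rfloor>}"
  have "?K \<lhd> ?F" by (rule ev.normal_kernel)
  then have "normal_closure ?F R \<subseteq> ?K"
    unfolding normal_closure_def R_def by blast
  moreover have "?K \<subseteq> normal_closure ?F R"
    unfolding normal_closure_def
    using short_relators_generate_kernel[OF k] by (auto simp: R_def)
  moreover have "word_eval G ` carrier ?F = carrier G"
  proof
    show "word_eval G ` carrier ?F \<subseteq> carrier G" using ev.hom_closed by blast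
    show "carrier G \<subseteq> word_eval G ` carrier ?F"
    proof
      fix g assume "g \<in> carrier G"
      then obtain w where "set w \<subseteq> UNIV \<times> S" "word_eval G w = g" using ex_word by blast
      then show "g \<in> word_eval G ` carrier ?F"
        by (intro image_eqI[of _ _ "free_reduce w"])
          (simp_all add: word_eval_free_reduce free_reduce_closed)
    qed
  qed
  ultimately have "has_presentation G S R"
    using gen_subset by (auto simp: has_presentation_def) (auto simp: R_def kernel_def)
  then show ?thesis unfolding boundedly_presented_def R_def by blast
qed

lemma boundedly_presented_iff:
  "boundedly_presented G S \<longleftrightarrow> coarsely_simply_connected (carrier G) d"
  using boundedly_presented_imp_coarsely_simply_connected
    coarsely_simply_connected_imp_boundedly_presented by blast

end

text \<open>A compact presentation comes with its own set of generators, whose word metric is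
  available only once the set is known to generate \<open>G\<close>.\<close>

lemma (in group) has_presentation_generate:
  assumes "has_presentation G S R"
  shows "generate G S = carrier G"
proof -
  have S: "S \<subseteq> carrier G" using assms by (simp add: has_presentation_def)
  have "word_eval G w \<in> generate G S" if "set w \<subseteq> UNIV \<times> S" for w
    using that
  proof (induction w)
    case (Cons x w)
    then have "letter_eval G x \<in> generate G S"
      by (auto simp: letter_eval_def intro: generate.intros)
    then show ?case using Cons by (auto intro: generate.eng)
  qed (simp add: generate.one)
  then have "word_eval G ` carrier (free_group S) \<subseteq> generate G S"
    by (auto dest: free_group_letters)
  moreover have "word_eval G ` carrier (free_group S) = carrier G"
    using assms by (simp add: has_presentation_def)
  ultimately show ?thesis using generate_incl[OF S] by blast
qed

section \<open>Compact generating sets\<close>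

text \<open>A geodesic word in \<open>S'\<close> is followed letter by letter. By left invariance
  each letter moves a point by its distance from \<open>\<one>\<close>, at most \<open>K\<close>,
  and inverting a letter keeps that distance.\<close>

lemma word_metric_comparison:
  fixes G (structure)
  assumes "generated_group G S" "generated_group G S'"
    and K: "\<And>s. s \<in> S' \<Longrightarrow> word_metric G S \<one> s \<le> K"
    and gh: "g \<in> carrier G" "h \<in> carrier G"
  shows "word_metric G S g h \<le> K * word_metric G S' g h"
proof -
  interpret A: generated_group G S by fact
  interpret B: generated_group G S' by fact
  have inv_dist: "A.d \<one> (inv s) = A.d \<one> s" if "s \<in> carrier G" for s
  proof -
    have "A.d \<one> (inv s) = A.d s \<one>" using that by (simp add: word_metric_def)
    then show ?thesis by (simp add: A.metric.commute)
  qed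
  have letter: "A.d g (g \<otimes> letter_eval G x) \<le> K" if "g \<in> carrier G" "x \<in> UNIV \<times> S'" for g x
  proof -
    have "A.d g (g \<otimes> letter_eval G x) = A.d \<one> (letter_eval G x)"
      using that B.letter_eval_in[OF that(2)] by (simp add: word_metric_def A.m_assoc[symmetric])
    then show ?thesis
      using that K B.gen_subset inv_dist by (auto simp: letter_eval_def)
  qed
  have word: "A.d g (g \<otimes> word_eval G w) \<le> K * length w"
    if "g \<in> carrier G" "set w \<subseteq> UNIV \<times> S'" for g w
    using that
  proof (induction w arbitrary: g)
    case (Cons x w)
    let ?h = "g \<otimes> letter_eval G x"
    have "A.d ?h (?h \<otimes> word_eval G w) \<le> K * length w" using Cons by simp
    moreover have "A.d g ?h \<le> K" using Cons.prems letter by simp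
    moreover have "A.d g (?h \<otimes> word_eval G w) \<le> A.d g ?h + A.d ?h (?h \<otimes> word_eval G w)"
      using Cons.prems by (intro A.metric.triangle) auto
    ultimately show ?case using Cons.prems by (simp add: A.m_assoc algebra_simps)
  qed simp
  obtain w where w: "set w \<subseteq> UNIV \<times> S'" "word_eval G w = inv g \<otimes> h" "real (length w) = B.d g h"
    using B.geodesic_word[OF gh] .
  have "g \<otimes> word_eval G w = h" using gh w(2) by (simp add: A.m_assoc[symmetric])
  then show ?thesis using word[OF gh(1) w(1)] w(3) by simp
qed

text \<open>By the Baire category theorem some ball of the word metric, being compact, has nonempty
  interior; finitely many translates of that interior cover a given compact set.\<close>

lemma (in topological_group) compactin_word_metric_bounded:
  assumes T: "Hausdorff_space T" "locally_compact_space T"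
    and S: "compactin T S" "generate G S = carrier G" and C: "compactin T C"
  shows "\<exists>K. \<forall>c\<in>C. word_metric G S \<one> c \<le> K"
proof -
  have "S \<subseteq> carrier G" using compactin_subset_topspace[OF S(1)] topspace_eq_carrier by simp
  then interpret generated_group G S using S(2) by unfold_locales
  \<comment> \<open>With \<open>\<one>\<close> among the factors, \<open>P n\<close> is the ball of
    radius \<open>n\<close> about \<open>\<one>\<close>, and it is compact as an image of a product
    of compact sets.\<close>
  define E where "E = insert \<one> (S \<union> (\<lambda>s. inv s) ` S)"
  define P where "P n = ((\<lambda>A. (\<lambda>(x, y). x \<otimes> y) ` (E \<times> A)) ^^ n) {\<one>}" for n :: nat
  have P_Suc: "P (Suc n) = (\<lambda>(x, y). x \<otimes> y) ` (E \<times> P n)" for n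
    by (simp add: P_def)
  have one: "compactin T {\<one>}" using topspace_eq_carrier by simp
  have "compactin T ({\<one>} \<union> (S \<union> (\<lambda>s. inv s) ` S))"
    using one S(1) image_compactin[OF S(1) continuous_inv] by (intro compactin_Un)
  then have E: "compactin T E" by (simp add: E_def)
  have P_compact: "compactin T (P n)" for n
  proof (induction n)
    case 0
    then show ?case using one by (simp add: P_def)
  next
    case (Suc n)
    then have "compactin (prod_topology T T) (E \<times> P n)" using E by (simp add: compactin_Times)
    then show ?case unfolding P_Suc using continuous_mult by (rule image_compactin)
  qed
  have P_word: "\<exists>w. set w \<subseteq> UNIV \<times> S \<and> length w \<le> n \<and> word_eval G w = g" if "g \<in> P n" for g n
    using that
  proof (induction n arbitrary: g)
    case 0
    then show ?case by (intro exI[of _ "[]"]) (simp add: P_def)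
  next
    case (Suc n)
    then obtain e h where e: "e \<in> E" "h \<in> P n" "g = e \<otimes> h" unfolding P_Suc by auto
    then obtain w where w: "set w \<subseteq> UNIV \<times> S" "length w \<le> n" "word_eval G w = h"
      using Suc.IH by blast
    show ?case
    proof (cases "e = \<one>")
      case True
      then have "g = word_eval G w" using e(3) w(3) word_eval_in[OF w(1)] by simp
      then show ?thesis using w(1,2) by (intro exI[of _ w]) simp
    next
      case False
      then obtain s where "s \<in> S" "e = s \<or> e = inv s" using e(1) by (auto simp: E_def)
      then have "(True, s) \<in> UNIV \<times> S \<and> e = letter_eval G (True, s) \<or>
          (False, s) \<in> UNIV \<times> S \<and> e = letter_eval G (False, s)"
        by (simp add: letter_eval_def)
      then obtain x where "x \<in> UNIV \<times> S" "e = letter_eval G x" by blast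
      then show ?thesis using e(3) w by (intro exI[of _ "x # w"]) simp
    qed
  qed
  have word_P: "word_eval G w \<in> P (length w)" if "set w \<subseteq> UNIV \<times> S" for w
    using that
  proof (induction w)
    case Nil
    then show ?case by (simp add: P_def)
  next
    case (Cons x w)
    then have "letter_eval G x \<in> E" by (auto simp: E_def letter_eval_def)
    then show ?case
      using Cons unfolding list.size add_0_right P_Suc
      by (auto simp: P_Suc intro!: image_eqI[of _ _ "(letter_eval G x, word_eval G w)"])
  qed
  have "carrier G \<subseteq> (\<Union>n. P n)"
  proof
    fix g assume "g \<in> carrier G"
    then obtain w where "set w \<subseteq> UNIV \<times> S" "word_eval G w = g" using ex_word by blast
    then show "g \<in> (\<Union>n. P n)" using word_P by blast
  qed
  moreover have "P n \<subseteq> carrier G" for n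
    using compactin_subset_topspace[OF P_compact] topspace_eq_carrier by simp
  ultimately have "(\<Union>n. P n) = topspace T" using topspace_eq_carrier by auto
  \<comment> \<open>The balls are compact, hence closed in a Hausdorff space, and countably many of
    them exhaust a nonempty space; so they cannot all have empty interior.\<close>
  then have "T interior_of (\<Union>(range P)) \<noteq> {}"
    using topspace_eq_carrier one_closed by (metis empty_iff interior_of_topspace)
  then obtain n where n: "T interior_of (P n) \<noteq> {}"
    using Baire_category_alt[of T "range P"] T P_compact compactin_imp_closedin
      locally_compact_Hausdorff_imp_regular_space by blast
  define U where "U = T interior_of (P n)"
  obtain u where u: "u \<in> U" using n U_def by blast
  have U: "openin T U" "U \<subseteq> P n" by (auto simp: U_def interior_of_subset)
  have uG: "u \<in> carrier G" using u U \<open>\<And>n. P n \<subseteq> carrier G\<close> by blast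
  \<comment> \<open>For \<open>g\<close> in the group this is the translate of \<open>U\<close> by
    \<open>g\<close>, written as a preimage so that openness follows from continuity.\<close>
  define V where "V g = {x \<in> topspace T. inv g \<otimes> x \<in> U}" for g
  have V: "openin T (V g)" if "g \<in> carrier G" for g
  proof -
    have "continuous_map T (prod_topology T T) (\<lambda>x. (inv g, x))"
      using that topspace_eq_carrier by (intro continuous_map_pairedI) auto
    from continuous_map_compose[OF this continuous_mult]
    have "continuous_map T T (\<lambda>x. inv g \<otimes> x)" by (simp add: comp_def)
    then show ?thesis unfolding V_def using U(1) by (rule openin_continuous_map_preimage)
  qed
  have CG: "C \<subseteq> carrier G" using compactin_subset_topspace[OF C] topspace_eq_carrier by simp
  have "C \<subseteq> \<Union>(V ` carrier G)"
  proof
    fix c assume "c \<in> C"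
    then have c: "c \<in> carrier G" using CG by blast
    then have "inv (c \<otimes> inv u) \<otimes> c = u" using uG by (simp add: inv_mult_group m_assoc)
    then have "c \<in> V (c \<otimes> inv u)" using c u topspace_eq_carrier by (simp add: V_def)
    then show "c \<in> \<Union>(V ` carrier G)" by (rule UN_I[rotated]) (simp add: c uG)
  qed
  then obtain \<F> where "finite \<F>" "\<F> \<subseteq> V ` carrier G" "C \<subseteq> \<Union>\<F>"
    using compactinD[OF C, of "V ` carrier G"] V by blast
  then obtain A where A: "A \<subseteq> carrier G" "finite A" "C \<subseteq> \<Union>(V ` A)"
    by (metis finite_subset_image)
  \<comment> \<open>The point \<open>c\<close> differs from some \<open>g\<close> in
    \<open>A\<close> by an element of \<open>P n\<close>. The sum is a crude bound for every
    \<open>d \<one> g\<close> at once and makes sense for empty \<open>A\<close>.\<close>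
  have "d \<one> c \<le> (\<Sum>g\<in>A. d \<one> g) + n" if "c \<in> C" for c
  proof -
    obtain g where g: "g \<in> A" "c \<in> V g" using A(3) \<open>c \<in> C\<close> by blast
    then have "inv g \<otimes> c \<in> P n" using U(2) by (auto simp: V_def)
    then obtain w where w: "set w \<subseteq> UNIV \<times> S" "length w \<le> n" "word_eval G w = inv g \<otimes> c"
      using P_word by blast
    have G: "g \<in> carrier G" "c \<in> carrier G" using g A(1) CG \<open>c \<in> C\<close> by auto
    then have "g \<otimes> word_eval G w = c" unfolding w(3) by (simp add: m_assoc[symmetric])
    then have "d g c \<le> n" using word_metric_le_length[OF G(1) w(1)] w(2) by simp
    moreover have "d \<one> g \<le> (\<Sum>g\<in>A. d \<one> g)"
      using g(1) A(2) by (intro member_le_sum) auto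
    ultimately show ?thesis using metric.triangle[OF one_closed G] by linarith
  qed
  then show ?thesis by blast
qed

lemma (in topological_group) coarsely_simply_connected_compact_generators:
  assumes T: "Hausdorff_space T" "locally_compact_space T"
    and S: "compactin T S" "generate G S = carrier G"
    and S': "compactin T S'" "generate G S' = carrier G"
    and csc: "coarsely_simply_connected (carrier G) (word_metric G S)"
  shows "coarsely_simply_connected (carrier G) (word_metric G S')"
proof -
  have gen: "generated_group G S" "generated_group G S'"
    using compactin_subset_topspace[OF S(1)] compactin_subset_topspace[OF S'(1)] S(2) S'(2)
      topspace_eq_carrier by (auto intro!: generated_group.intro generated_group_axioms.intro is_group)
  obtain K K' where K: "\<And>s. s \<in> S' \<Longrightarrow> word_metric G S \<one> s \<le> K"
    and K': "\<And>s. s \<in> S \<Longrightarrow> word_metric G S' \<one> s \<le> K'"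
    using compactin_word_metric_bounded[OF T S S'(1)] compactin_word_metric_bounded[OF T S' S(1)]
    by blast
  \<comment> \<open>One constant serves both comparisons; the 1 meets the lower bound required for a
    change of metric.\<close>
  let ?K = "max 1 (max K K')"
  show ?thesis
  proof (rule coarsely_simply_connected_mono[OF csc])
    show "word_metric G S x y \<le> ?K * word_metric G S' x y"
      if "x \<in> carrier G" "y \<in> carrier G" for x y
      by (rule word_metric_comparison[OF gen _ that]) (use K in fastforce)
    show "word_metric G S' x y \<le> ?K * word_metric G S x y"
      if "x \<in> carrier G" "y \<in> carrier G" for x y
      by (rule word_metric_comparison[OF gen(2,1) _ that]) (use K' in fastforce)
  qed simp
qed

theorem corollary4p9:
  fixes G :: "('a, 'b) monoid_scheme"
  assumes "group G"
  shows
    "(\<forall>S. S \<subseteq> carrier G \<and> generate G S = carrier G \<longrightarrow>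
        (boundedly_presented G S \<longleftrightarrow>
         coarsely_simply_connected (carrier G) (word_metric G S))) \<and>
     (\<forall>T. topological_group G T \<and> Hausdorff_space T \<and> locally_compact_space T \<and>
          compactly_generated G T \<longrightarrow>
        (\<forall>S. compactin T S \<and> generate G S = carrier G \<longrightarrow>
          (compactly_presented G T \<longleftrightarrow>
           coarsely_simply_connected (carrier G) (word_metric G S))))"
proof (intro conjI allI impI)
  have presented: "boundedly_presented G S \<longleftrightarrow>
      coarsely_simply_connected (carrier G) (word_metric G S)"
    if "S \<subseteq> carrier G" "generate G S = carrier G" for S
    using that assms
    by (intro generated_group.boundedly_presented_iff generated_group.intro
        generated_group_axioms.intro)
  then show "boundedly_presented G S \<longleftrightarrow>
      coarsely_simply_connected (carrier G) (word_metric G S)"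
    if "S \<subseteq> carrier G \<and> generate G S = carrier G" for S
    using that by blast
  fix T S
  assume "topological_group G T \<and> Hausdorff_space T \<and> locally_compact_space T \<and>
    compactly_generated G T" and "compactin T S \<and> generate G S = carrier G"
  then have T: "topological_group G T" "Hausdorff_space T" "locally_compact_space T"
    and S: "compactin T S" "generate G S = carrier G" by auto
  interpret topological_group G T by fact
  have subset: "C \<subseteq> carrier G" if "compactin T C" for C
    using compactin_subset_topspace[OF that] topspace_eq_carrier by simp
  show "compactly_presented G T \<longleftrightarrow> coarsely_simply_connected (carrier G) (word_metric G S)"
  proof
    \<comment> \<open>The compact set that presents \<open>G\<close> need not be \<open>S\<close>,
      so coarse simple connectedness is first obtained for its word metric and then carried over to
      that of \<open>S\<close>.\<close>
    assume "compactly_presented G T"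
    then obtain S' where S': "compactin T S'" "boundedly_presented G S'"
      unfolding compactly_presented_def by blast
    then have gen: "generate G S' = carrier G"
      unfolding boundedly_presented_def using has_presentation_generate by blast
    then have "coarsely_simply_connected (carrier G) (word_metric G S')"
      using presented subset S' by blast
    then show "coarsely_simply_connected (carrier G) (word_metric G S)"
      by (rule coarsely_simply_connected_compact_generators[OF T(2,3) S'(1) gen S])
  next
    assume "coarsely_simply_connected (carrier G) (word_metric G S)"
    then have "boundedly_presented G S" using presented subset S by blast
    then show "compactly_presented G T"
      unfolding compactly_presented_def using T(2) S(1) by blast
  qed
qed

end
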